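(* Let $k \geq 3$ be an integer and let $G$ be a connected $k$-regular graph. Then $$\frac{i(G)}{\gamma(G)} \leq \frac{k}{2},$$ with equality if and only if $G = K_{k,k}$ (up to isomorphism), where $\gamma(G)$ denotes the domination number of $G$, $i(G)$ denotes the independent domination number of $G$, and $K_{k,k}$ is the complete bipartite graph with both parts of size $k$.
   Context: Graphs are finite, simple and undirected. A graph $G=(V,E)$ is $k$-regular if every vertex has degree $k$. A set $S \subseteq V$ is a dominating set of $G$ if every vertex of $G$ is in $S$ or is adjacent to a vertex in $S$. A set $U \subseteq V$ is independent if no two vertices in $U$ are adjacent. An independent dominating set is a dominating set that is also independent. The domination number $\gamma(G)$ is the minimum cardinality of a dominating set of $G$. The independent domination number $i(G)$ is the minimum cardinality of an independent dominating set of $G$ (equivalently, the minimum cardinality of a maximal independent set of $G$). *)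

theory Defs
  imports Complex_Main "Graph_Theory.Graph_Theory"
begin

text \<open>
  A finite simple undirected graph is a \<^locale>\<open>graph\<close>: a finite symmetric digraph without
  loops and multiple arcs, in which an undirected edge is a pair of opposite arcs.
  Hence \<open>u\<close> and \<open>v\<close> are adjacent iff \<open>u \<rightarrow>\<^bsub>G\<^esub> v\<close>, and the degree of a vertex is its out-degree.
\<close>

definition regular :: "nat \<Rightarrow> ('a, 'b) pre_digraph \<Rightarrow> bool" where
  "regular k G \<longleftrightarrow> (\<forall>v \<in> verts G. out_degree G v = k)"

definition dominating_set :: "('a, 'b) pre_digraph \<Rightarrow> 'a set \<Rightarrow> bool" where
  "dominating_set G S \<longleftrightarrow>
     S \<subseteq> verts G \<and> (\<forall>v \<in> verts G. v \<in> S \<or> (\<exists>u \<in> S. v \<rightarrow>\<^bsub>G\<^esub> u))"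

definition independent_set :: "('a, 'b) pre_digraph \<Rightarrow> 'a set \<Rightarrow> bool" where
  "independent_set G U \<longleftrightarrow> U \<subseteq> verts G \<and> (\<forall>u \<in> U. \<forall>v \<in> U. \<not> u \<rightarrow>\<^bsub>G\<^esub> v)"

definition domination_number :: "('a, 'b) pre_digraph \<Rightarrow> nat" where
  "domination_number G = Min (card ` {S. dominating_set G S})"

definition independent_domination_number :: "('a, 'b) pre_digraph \<Rightarrow> nat" where
  "independent_domination_number G =
     Min (card ` {S. dominating_set G S \<and> independent_set G S})"

text \<open>Both minima are taken over finite nonempty sets.\<close>

lemma (in graph) finite_dominating_sets: "finite {S. dominating_set G S}"
  by (rule finite_subset[of _ "Pow (verts G)"]) (auto simp: dominating_set_def)

lemma (in graph) ex_independent_dominating_set: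
  "\<exists>S. dominating_set G S \<and> independent_set G S"
proof -
  have fin: "finite {U. independent_set G U}"
    by (rule finite_subset[of _ "Pow (verts G)"]) (auto simp: independent_set_def)
  have "{} \<in> {U. independent_set G U}" by (simp add: independent_set_def)
  from finite_has_maximal2[OF fin this] obtain M
    where M: "independent_set G M" and max: "\<forall>U. independent_set G U \<longrightarrow> M \<subseteq> U \<longrightarrow> M = U"
    by (elim bexE) simp
  have "v \<in> M \<or> (\<exists>u \<in> M. v \<rightarrow>\<^bsub>G\<^esub> u)" if v: "v \<in> verts G" for v
  proof (rule ccontr)
    assume neg: "\<not> (v \<in> M \<or> (\<exists>u \<in> M. v \<rightarrow>\<^bsub>G\<^esub> u))"
    have "\<not> v \<rightarrow>\<^bsub>G\<^esub> v" using adj_not_same by metis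
    moreover have "\<not> v \<rightarrow>\<^bsub>G\<^esub> u" "\<not> u \<rightarrow>\<^bsub>G\<^esub> v" if "u \<in> M" for u
      using neg that arcs_ends_symmetric[OF sym_arcs] by metis+
    ultimately have "independent_set G (insert v M)"
      using M v by (simp add: independent_set_def)
    then have "M = insert v M" using max by (metis subset_insertI)
    then show False using neg by (metis insertI1)
  qed
  then have "dominating_set G M"
    using M by (simp add: dominating_set_def independent_set_def)
  then show ?thesis using M by metis
qed

end

theory Submission
  imports Defs
begin

text \<open>
  Two upper bounds for \<open>i(G)\<close>, neither of which suffices alone, are averaged. Write
  \<open>\<gamma> = \<gamma>(G)\<close>, \<open>i = i(G)\<close> and \<open>n\<close> for the order of \<open>G\<close>, let \<open>D\<close> be a minimum dominating set,
  and let \<open>d(v)\<close> be the degree of \<open>v \<in> D\<close> inside the subgraph induced by \<open>D\<close>.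

  The first bound is \<open>2i \<le> n\<close>, because in a regular graph an independent set has at most as many
  vertices as its complement (\<open>regular_independent_set_le_half\<close>). Moreover each \<open>v \<in> D\<close> accounts for
  itself and for its \<open>k - d(v)\<close> neighbours outside \<open>D\<close>, so \<open>n \<le> \<Sum>v\<in>D. k + 1 - d(v)\<close>. This is good when
  \<open>D\<close> induces many edges and fails only because of the vertices with \<open>d(v) = 0\<close>.

  The second bound starts from an independent set \<open>I \<subseteq> D\<close> that dominates \<open>D\<close> and extends it to an
  independent dominating set. All new vertices are neighbours, outside \<open>D\<close>, of vertices of
  \<open>D - I\<close>, so \<open>i \<le> card I + (\<Sum>v\<in>D - I. k - d(v))\<close>. If \<open>I\<close> is chosen greedily, as in the weighted
  Caro-Wei theorem with weights \<open>k - 1 - d(v)\<close> (\<open>greedy_independent_set\<close>), the result is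
  \<open>i \<le> \<Sum>v\<in>D. k + 1 - d(v) - k / (d(v) + 1)\<close>
  (\<open>independent_domination_number_le_greedy_sum\<close>). This is good when \<open>D\<close> induces few edges.

  The second bound plus \<open>k - 2\<close> times the first gives \<open>(k - 1) i\<close> on the left, and on the
  right a sum over \<open>D\<close> in which every term is at most \<open>k (k - 1) / 2\<close>: the slack of the term of
  \<open>v\<close> is \<open>k d(v) (d(v) - 1) / (2 (d(v) + 1))\<close>, which is nonnegative since \<open>d(v)\<close> is an integer
  (\<open>vertex_weight_le\<close>). Hence \<open>i \<le> k \<gamma> / 2\<close>.

  In case of equality the first bound, having the positive weight \<open>k - 2\<close>, is tight, that is,
  \<open>2i = n\<close>. Then every maximal independent set has exactly \<open>n/2\<close> vertices and, by counting edges,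
  an independent complement. Two nonadjacent vertices from different sides of one such
  bipartition could be extended to a maximal independent set, hence to another bipartition; but
  a connected graph has only one. So \<open>G\<close> is complete bipartite
  (\<open>extremal_imp_complete_bipartite\<close>).
\<close>

section \<open>Neighbourhoods, domination and independence\<close>

definition neighbourhood :: "('a, 'b) pre_digraph \<Rightarrow> 'a \<Rightarrow> 'a set" where
  "neighbourhood G v = {u. v \<rightarrow>\<^bsub>G\<^esub> u}"

context graph
begin

lemma adjacent_sym: "u \<rightarrow>\<^bsub>G\<^esub> v \<Longrightarrow> v \<rightarrow>\<^bsub>G\<^esub> u"
  using arcs_ends_symmetric[OF sym_arcs] by metis

lemma not_adjacent_self: "\<not> v \<rightarrow>\<^bsub>G\<^esub> v"
  using adj_not_same by metis

lemma neighbourhood_subset: "neighbourhood G v \<subseteq> verts G"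
  by (auto simp: neighbourhood_def dest: adj_in_verts)

lemma finite_neighbourhood: "finite (neighbourhood G v)"
  using neighbourhood_subset by (rule finite_subset) simp

lemma card_neighbourhood: "card (neighbourhood G v) = out_degree G v"
proof -
  have "neighbourhood G v = head G ` out_arcs G v"
    by (auto simp: neighbourhood_def arcs_ends_conv out_arcs_def)
  moreover have "inj_on (head G) (out_arcs G v)"
    by (rule inj_onI, rule no_multi_arcs) (simp_all add: arc_to_ends_def)
  ultimately show ?thesis
    by (simp add: card_image out_degree_def)
qed

lemma finite_subset_verts: "S \<subseteq> verts G \<Longrightarrow> finite S"
  by (erule finite_subset) simp

lemma card_neighbourhood_regular:
  "regular k G \<Longrightarrow> v \<in> verts G \<Longrightarrow> card (neighbourhood G v) = k"
  by (simp add: regular_def card_neighbourhood)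

text \<open>A maximal independent set is dominating, as an undominated vertex could be added to it.\<close>

lemma independent_set_extends:
  assumes "independent_set G U"
  obtains M where "U \<subseteq> M" "independent_set G M" "dominating_set G M"
proof -
  have fin: "finite {U. independent_set G U}"
    by (rule finite_subset[of _ "Pow (verts G)"]) (auto simp: independent_set_def)
  have "\<exists>M \<in> {U. independent_set G U}. U \<subseteq> M \<and>
      (\<forall>W \<in> {U. independent_set G U}. M \<subseteq> W \<longrightarrow> M = W)"
    by (rule finite_has_maximal2[OF fin]) (use assms in simp)
  then obtain M where UM: "U \<subseteq> M" and M: "independent_set G M"
      and max: "\<And>W. independent_set G W \<Longrightarrow> M \<subseteq> W \<Longrightarrow> M = W"
    by auto
  have "v \<in> M \<or> (\<exists>u \<in> M. v \<rightarrow>\<^bsub>G\<^esub> u)" if v: "v \<in> verts G" for v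
  proof (rule ccontr)
    assume neg: "\<not> (v \<in> M \<or> (\<exists>u \<in> M. v \<rightarrow>\<^bsub>G\<^esub> u))"
    then have "independent_set G (insert v M)"
      using M v not_adjacent_self adjacent_sym unfolding independent_set_def by blast
    with max neg show False by blast
  qed
  then have "dominating_set G M"
    using M by (simp add: dominating_set_def independent_set_def)
  with UM M that show thesis by blast
qed

lemma domination_number_le: "dominating_set G S \<Longrightarrow> domination_number G \<le> card S"
  unfolding domination_number_def
  by (rule Min_le) (auto intro: finite_dominating_sets)

lemma minimum_dominating_setE:
  obtains D where "dominating_set G D" "card D = domination_number G"
proof -
  have "domination_number G \<in> card ` {S. dominating_set G S}"
    unfolding domination_number_def
    by (rule Min_in) (use finite_dominating_sets ex_independent_dominating_set in auto)
  with that show thesis by auto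
qed

lemma finite_independent_dominating_sets:
  "finite {S. dominating_set G S \<and> independent_set G S}"
  by (rule finite_subset[OF _ finite_dominating_sets]) auto

lemma independent_domination_number_le:
  "dominating_set G S \<Longrightarrow> independent_set G S \<Longrightarrow> independent_domination_number G \<le> card S"
  unfolding independent_domination_number_def
  by (rule Min_le) (auto intro: finite_independent_dominating_sets)

lemma minimum_independent_dominating_setE:
  obtains M where "dominating_set G M" "independent_set G M"
    "card M = independent_domination_number G"
proof -
  have "independent_domination_number G \<in>
      card ` {S. dominating_set G S \<and> independent_set G S}"
    unfolding independent_domination_number_def
    by (rule Min_in)
      (use finite_independent_dominating_sets ex_independent_dominating_set in auto)
  with that show thesis by auto
qed

section \<open>Independent sets in regular graphs\<close>

text \<open>
  Both sides count the edges between \<open>U\<close> and its complement; these are all the edges at \<open>U\<close>.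
\<close>

lemma regular_independent_set_edge_count:
  assumes reg: "regular k G" and U: "independent_set G U"
  shows "k * card U = (\<Sum>w \<in> verts G - U. card (neighbourhood G w \<inter> U))"
proof -
  have UV: "U \<subseteq> verts G" using U by (simp add: independent_set_def)
  have fin: "finite U" "finite (verts G - U)" using UV finite_subset_verts by auto
  have "card (neighbourhood G u) = card {w \<in> verts G - U. u \<rightarrow>\<^bsub>G\<^esub> w}" if "u \<in> U" for u
  proof -
    have "neighbourhood G u = {w \<in> verts G - U. u \<rightarrow>\<^bsub>G\<^esub> w}"
      using U that by (auto simp: neighbourhood_def independent_set_def dest: adj_in_verts)
    then show ?thesis by simp
  qed
  then have "(\<Sum>u\<in>U. card {w \<in> verts G - U. u \<rightarrow>\<^bsub>G\<^esub> w}) = (\<Sum>u\<in>U. k)"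
    using UV card_neighbourhood_regular[OF reg] by (intro sum.cong refl) (metis subsetD)
  moreover have "(\<Sum>u\<in>U. card {w \<in> verts G - U. u \<rightarrow>\<^bsub>G\<^esub> w})
      = (\<Sum>w\<in>verts G - U. card {u \<in> U. u \<rightarrow>\<^bsub>G\<^esub> w})"
    by (rule sum_multicount_gen) (use fin in auto)
  moreover have "{u \<in> U. u \<rightarrow>\<^bsub>G\<^esub> w} = neighbourhood G w \<inter> U" for w
    using adjacent_sym by (auto simp: neighbourhood_def)
  ultimately show ?thesis by (simp add: mult.commute)
qed

lemma card_neighbourhood_inter_le:
  assumes "regular k G" "w \<in> verts G - U"
  shows "card (neighbourhood G w \<inter> U) \<le> k"
  using card_mono[OF finite_neighbourhood[of w], of "neighbourhood G w \<inter> U"]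
    card_neighbourhood_regular[of k w] assms by auto

text \<open>In the edge count, a vertex outside \<open>U\<close> receives at most \<open>k\<close> of the \<open>k * card U\<close> edges.\<close>

lemma regular_independent_set_le_half:
  assumes reg: "regular k G" and k: "k > 0" and U: "independent_set G U"
  shows "2 * card U \<le> card (verts G)"
proof -
  have "k * card U \<le> k * card (verts G - U)"
    unfolding regular_independent_set_edge_count[OF reg U]
    using sum_bounded_above[of "verts G - U" "\<lambda>w. card (neighbourhood G w \<inter> U)" k]
      card_neighbourhood_inter_le[OF reg] by (simp add: mult.commute)
  moreover have "U \<subseteq> verts G" using U by (simp add: independent_set_def)
  ultimately show ?thesis
    using k card_Diff_subset[of U "verts G"] card_mono[of "verts G" U] finite_subset_verts[of U]
    by simp
qed

text \<open>
  If \<open>U\<close> is exactly half of the vertices, the edge count is tight at each vertex outside \<open>U\<close>: all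
  its \<open>k\<close> neighbours lie in \<open>U\<close>.
\<close>

lemma regular_half_independent_set_complement:
  assumes reg: "regular k G" and U: "independent_set G U"
    and half: "2 * card U = card (verts G)"
  shows "independent_set G (verts G - U)"
proof -
  have UV: "U \<subseteq> verts G" using U by (simp add: independent_set_def)
  have "card (verts G - U) = card U"
    using half UV card_Diff_subset[of U "verts G"] finite_subset_verts[of U] by simp
  then have eq: "(\<Sum>w \<in> verts G - U. card (neighbourhood G w \<inter> U)) = (\<Sum>w \<in> verts G - U. k)"
    using regular_independent_set_edge_count[OF reg U] by (simp add: mult.commute)
  have "card (neighbourhood G w \<inter> U) = k" if "w \<in> verts G - U" for w
    by (rule sum_mono_inv[OF eq _ that]) (auto intro: card_neighbourhood_inter_le[OF reg])
  then have "neighbourhood G w \<inter> U = neighbourhood G w" if "w \<in> verts G - U" for w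
    using that card_subset_eq[OF finite_neighbourhood[of w], of "neighbourhood G w \<inter> U"]
      card_neighbourhood_regular[OF reg, of w] by auto
  then show ?thesis unfolding independent_set_def neighbourhood_def by blast
qed

section \<open>A greedy independent subset of a dominating set\<close>

text \<open>
  The weighted Caro-Wei theorem, with the weight of \<open>v\<close> written as \<open>f v * (d(v) + 1)\<close>, where
  \<open>d(v)\<close> is the degree of \<open>v\<close> within \<open>D\<close>. The greedy choice of a vertex \<open>v\<close> with maximal \<open>f v\<close>
  deletes at most \<open>d(v) + 1\<close> vertices, whose values of \<open>f\<close> add up to at most the weight gained.
  The degrees refer to the fixed set \<open>D\<close>, not to the shrinking set \<open>S\<close>, so that \<open>f\<close> stays the same
  throughout the induction.
\<close>

lemma greedy_independent_set:
  fixes f :: "'a \<Rightarrow> real"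
  assumes "S \<subseteq> D" "D \<subseteq> verts G" "\<And>v. v \<in> S \<Longrightarrow> 0 \<le> f v"
  obtains I where "I \<subseteq> S" "independent_set G I" "\<And>v. v \<in> S \<Longrightarrow> v \<in> I \<or> (\<exists>u \<in> I. v \<rightarrow>\<^bsub>G\<^esub> u)"
    "sum f S \<le> (\<Sum>v\<in>I. f v * (card (neighbourhood G v \<inter> D) + 1))"
proof -
  have "finite S" using assms finite_subset_verts by auto
  then have "\<exists>I \<subseteq> S. independent_set G I \<and> (\<forall>v \<in> S. v \<in> I \<or> (\<exists>u \<in> I. v \<rightarrow>\<^bsub>G\<^esub> u)) \<and>
      sum f S \<le> (\<Sum>v\<in>I. f v * (card (neighbourhood G v \<inter> D) + 1))"
    using assms
  proof (induction S rule: finite_psubset_induct)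
    case (psubset S)
    show ?case
    proof (cases "S = {}")
      case True
      then show ?thesis by (auto simp: independent_set_def)
    next
      case False
      have "Max (f ` S) \<in> f ` S" using False psubset.hyps by (intro Max_in) auto
      then obtain v where v: "v \<in> S" and "f v = Max (f ` S)" by auto
      then have max: "f u \<le> f v" if "u \<in> S" for u
        using that psubset.hyps by auto
      \<comment> \<open>the vertices that can no longer be chosen after \<open>v\<close>\<close>
      define R where "R = S \<inter> insert v (neighbourhood G v)"
      have "\<exists>I \<subseteq> S - R. independent_set G I \<and> (\<forall>v \<in> S - R. v \<in> I \<or> (\<exists>u \<in> I. v \<rightarrow>\<^bsub>G\<^esub> u)) \<and>
          sum f (S - R) \<le> (\<Sum>v\<in>I. f v * (card (neighbourhood G v \<inter> D) + 1))"
        by (rule psubset.IH) (use psubset.prems v in \<open>auto simp: R_def\<close>)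
      then obtain I where I: "I \<subseteq> S - R" "independent_set G I"
          "\<And>v. v \<in> S - R \<Longrightarrow> v \<in> I \<or> (\<exists>u \<in> I. v \<rightarrow>\<^bsub>G\<^esub> u)"
          "sum f (S - R) \<le> (\<Sum>v\<in>I. f v * (card (neighbourhood G v \<inter> D) + 1))"
        by blast
      have fin: "finite I" using I(1) psubset.hyps by (meson finite_Diff finite_subset)
      have "v \<notin> I" using I(1) v by (auto simp: R_def)
      have fv: "0 \<le> f v" using psubset.prems v by blast
      have indep: "independent_set G (insert v I)"
      proof -
        have "\<not> v \<rightarrow>\<^bsub>G\<^esub> u" if "u \<in> I" for u
          using that I(1) by (auto simp: R_def neighbourhood_def)
        moreover have "v \<in> verts G" using v psubset.prems by auto
        ultimately show ?thesis
          using I(2) not_adjacent_self adjacent_sym unfolding independent_set_def by blast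
      qed
      have dom: "u \<in> insert v I \<or> (\<exists>w \<in> insert v I. u \<rightarrow>\<^bsub>G\<^esub> w)" if "u \<in> S" for u
      proof (cases "u \<in> R")
        case True
        then show ?thesis using adjacent_sym by (auto simp: R_def neighbourhood_def)
      next
        case False
        then show ?thesis using I(3) that by blast
      qed
      have "R \<subseteq> insert v (neighbourhood G v \<inter> D)" using psubset.prems by (auto simp: R_def)
      then have "card R \<le> card (insert v (neighbourhood G v \<inter> D))"
        by (rule card_mono[rotated]) (simp add: finite_neighbourhood)
      also have "\<dots> \<le> card (neighbourhood G v \<inter> D) + 1"
        by (simp add: card_insert_if finite_neighbourhood)
      finally have cardR: "card R \<le> card (neighbourhood G v \<inter> D) + 1" .
      have "sum f R \<le> of_nat (card R) * f v"
        by (rule sum_bounded_above) (auto simp: R_def max)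
      also have "\<dots> \<le> f v * (card (neighbourhood G v \<inter> D) + 1)"
        using mult_right_mono[OF _ fv] cardR by (metis mult.commute of_nat_le_iff)
      finally have "sum f R \<le> f v * (card (neighbourhood G v \<inter> D) + 1)" .
      moreover have "sum f S = sum f (S - R) + sum f R"
        by (rule sum.subset_diff) (use psubset.hyps in \<open>auto simp: R_def\<close>)
      ultimately have
        "sum f S \<le> (\<Sum>v\<in>insert v I. f v * (card (neighbourhood G v \<inter> D) + 1))"
        using I(4) fin \<open>v \<notin> I\<close> by simp
      moreover have "insert v I \<subseteq> S" using v I(1) by auto
      ultimately show ?thesis using indep dom by blast
    qed
  qed
  with that show thesis by blast
qed

section \<open>Two upper bounds in terms of the degrees inside a dominating set\<close>

text \<open>
  A vertex of \<open>D\<close> with all its neighbours in \<open>D\<close> could be removed: it would be dominated by a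
  neighbour, and it dominates nothing outside \<open>D\<close>. The strict inequality makes the weights
  \<open>k - 1 - d(v)\<close> of the greedy choice nonnegative.
\<close>

lemma minimum_dominating_set_degree_less:
  assumes reg: "regular k G" and k: "k > 0"
    and D: "dominating_set G D" "card D = domination_number G" and v: "v \<in> D"
  shows "card (neighbourhood G v \<inter> D) < k"
proof (rule ccontr)
  assume "\<not> ?thesis"
  moreover have vV: "v \<in> verts G" using D v by (auto simp: dominating_set_def)
  ultimately have "neighbourhood G v \<inter> D = neighbourhood G v"
    using card_neighbourhood_regular[OF reg, of v] by (intro card_seteq finite_neighbourhood) auto
  then have sub: "neighbourhood G v \<subseteq> D" by blast
  have "neighbourhood G v \<noteq> {}"
    using card_neighbourhood_regular[OF reg vV] k by auto
  then obtain u where u: "u \<in> D" "v \<rightarrow>\<^bsub>G\<^esub> u" using sub by (auto simp: neighbourhood_def)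
  have "w \<in> D - {v} \<or> (\<exists>u \<in> D - {v}. w \<rightarrow>\<^bsub>G\<^esub> u)" if w: "w \<in> verts G" for w
  proof (cases "w = v")
    case True
    then show ?thesis using u not_adjacent_self by blast
  next
    case False
    have "w \<in> D" if "w \<rightarrow>\<^bsub>G\<^esub> v"
      using adjacent_sym[OF that] sub by (auto simp: neighbourhood_def)
    with False D(1) w show ?thesis unfolding dominating_set_def by blast
  qed
  then have "dominating_set G (D - {v})"
    using D(1) by (auto simp: dominating_set_def)
  then have "card D \<le> card (D - {v})" using domination_number_le D(2) by simp
  moreover have "finite D" using D(1) finite_subset_verts by (auto simp: dominating_set_def)
  ultimately show False using v card_Diff1_less by (metis leD)
qed

lemma card_external_neighbours:
  assumes "regular k G" "v \<in> verts G"
  shows "real (card (neighbourhood G v - D)) = real k - card (neighbourhood G v \<inter> D)"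
  using card_Int_Diff[OF finite_neighbourhood[of v], of D]
    card_neighbourhood_regular[OF assms] by simp

text \<open>
  The union bound that underlies both estimates: it is used with \<open>T = D\<close> for the order of the
  graph, and with the rejected vertices \<open>T = D - I\<close> for the greedy estimate.
\<close>

lemma card_externally_covered_le:
  assumes "regular k G" "T \<subseteq> verts G" and X: "X \<subseteq> (\<Union>v\<in>T. neighbourhood G v - D)"
  shows "real (card X) \<le> (\<Sum>v\<in>T. real k - card (neighbourhood G v \<inter> D))"
proof -
  have T: "finite T" using assms finite_subset_verts by auto
  have "card X \<le> card (\<Union>v\<in>T. neighbourhood G v - D)"
    using X T by (intro card_mono) (auto intro: finite_neighbourhood)
  also have "\<dots> \<le> (\<Sum>v\<in>T. card (neighbourhood G v - D))"
    by (rule card_UN_le[OF T])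
  finally have "real (card X) \<le> real (\<Sum>v\<in>T. card (neighbourhood G v - D))"
    by (rule of_nat_mono)
  also have "\<dots> = (\<Sum>v\<in>T. real k - card (neighbourhood G v \<inter> D))"
    unfolding of_nat_sum
    by (rule sum.cong) (use assms card_external_neighbours in auto)
  finally show ?thesis .
qed

lemma order_le_dominating_set_sum:
  assumes reg: "regular k G" and D: "dominating_set G D"
  shows "real (card (verts G)) \<le> (\<Sum>v\<in>D. real k + 1 - card (neighbourhood G v \<inter> D))"
proof -
  have DV: "D \<subseteq> verts G" using D by (simp add: dominating_set_def)
  have "verts G - D \<subseteq> (\<Union>v\<in>D. neighbourhood G v - D)"
    using D adjacent_sym by (fastforce simp: dominating_set_def neighbourhood_def)
  from card_externally_covered_le[OF reg DV this]
  have "real (card (verts G - D)) \<le> (\<Sum>v\<in>D. real k - card (neighbourhood G v \<inter> D))" .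
  moreover have "card (verts G) = card (verts G - D) + card D"
    using card_Diff_subset[of D "verts G"] card_mono[of "verts G" D] DV finite_subset_verts[OF DV]
    by simp
  ultimately show ?thesis by (simp add: sum.distrib sum_subtractf algebra_simps)
qed

text \<open>
  Extending \<open>I\<close> to an independent dominating set adds no vertex of \<open>D\<close>, since \<open>I\<close> dominates \<open>D\<close>,
  and no neighbour of \<open>I\<close>. So putting \<open>v \<in> D\<close> into \<open>I\<close> costs \<open>1\<close>, leaving it out costs at most
  \<open>k - d(v)\<close>, and the greedy choice makes the total saving \<open>\<Sum>v\<in>I. k - 1 - d(v)\<close> large.
\<close>

lemma independent_domination_number_le_greedy_sum:
  assumes reg: "regular k G" and k: "k > 0"
    and D: "dominating_set G D" "card D = domination_number G"
  shows "real (independent_domination_number G) \<le>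
    (\<Sum>v\<in>D. real k + 1 - card (neighbourhood G v \<inter> D) - k / (card (neighbourhood G v \<inter> D) + 1))"
proof -
  define d where "d v = card (neighbourhood G v \<inter> D)" for v
  \<comment> \<open>the saving \<open>k - 1 - d v\<close> divided by \<open>d v + 1\<close>\<close>
  define f where "f v = real k / (d v + 1) - 1" for v
  have DV: "D \<subseteq> verts G" using D by (simp add: dominating_set_def)
  have finD: "finite D" using DV by (rule finite_subset_verts)
  have deg: "d v < k" if "v \<in> D" for v
    unfolding d_def by (rule minimum_dominating_set_degree_less[OF reg k D that])
  have "0 \<le> f v" if "v \<in> D" for v
    using deg[OF that] by (simp add: f_def field_simps)
  then obtain I where I: "I \<subseteq> D" "independent_set G I"
      "\<And>v. v \<in> D \<Longrightarrow> v \<in> I \<or> (\<exists>u \<in> I. v \<rightarrow>\<^bsub>G\<^esub> u)"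
      "sum f D \<le> (\<Sum>v\<in>I. f v * (d v + 1))"
    using greedy_independent_set[OF subset_refl DV, of f] unfolding d_def by blast
  obtain M where M: "I \<subseteq> M" "independent_set G M" "dominating_set G M"
    using independent_set_extends[OF I(2)] .
  have MV: "M \<subseteq> verts G" using M(2) by (simp add: independent_set_def)
  have "M - I \<subseteq> (\<Union>v\<in>D - I. neighbourhood G v - D)"
  proof
    fix x assume x: "x \<in> M - I"
    then have noI: "\<not> x \<rightarrow>\<^bsub>G\<^esub> u" if "u \<in> I" for u
      using that M by (auto simp: independent_set_def)
    then have "x \<notin> D" using x I(3) by blast
    moreover obtain v where "v \<in> D" "x \<rightarrow>\<^bsub>G\<^esub> v"
      using D(1) MV x \<open>x \<notin> D\<close> by (auto simp: dominating_set_def)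
    ultimately show "x \<in> (\<Union>v\<in>D - I. neighbourhood G v - D)"
      using noI adjacent_sym by (auto simp: neighbourhood_def)
  qed
  from card_externally_covered_le[OF reg _ this] DV
  have "real (card (M - I)) \<le> (\<Sum>v\<in>D - I. real k - d v)" unfolding d_def by blast
  moreover have "card M = card (M - I) + card I"
    using card_Diff_subset[of I M] card_mono[of M I] M(1) finite_subset_verts[OF MV]
      finite_subset[of I M] by simp
  moreover have "(\<Sum>v\<in>D. real k - d v) = (\<Sum>v\<in>D - I. real k - d v) + (\<Sum>v\<in>I. real k - d v)"
    by (rule sum.subset_diff[OF I(1) finD])
  moreover have "(\<Sum>v\<in>I. f v * (d v + 1)) = (\<Sum>v\<in>I. real k - d v) - card I"
  proof -
    have "(\<Sum>v\<in>I. f v * (d v + 1)) = (\<Sum>v\<in>I. real k - d v - 1)"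
      by (rule sum.cong) (auto simp: f_def field_simps)
    then show ?thesis by (simp add: sum_subtractf)
  qed
  ultimately have "real (card M) \<le> (\<Sum>v\<in>D. real k - d v) - sum f D"
    using I(4) by linarith
  also have "\<dots> = (\<Sum>v\<in>D. real k + 1 - d v - k / (d v + 1))"
    unfolding sum_subtractf[symmetric] by (rule sum.cong) (auto simp: f_def)
  finally show ?thesis
    using independent_domination_number_le[OF M(3,2)] unfolding d_def by linarith
qed

lemma two_independent_domination_number_le_order:
  assumes "regular k G" "k > 0"
  shows "2 * independent_domination_number G \<le> card (verts G)"
proof -
  obtain M where M: "dominating_set G M" "independent_set G M"
      "card M = independent_domination_number G"
    by (rule minimum_independent_dominating_setE)
  show ?thesis
    using regular_independent_set_le_half[OF assms M(2)] unfolding M(3) .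
qed

section \<open>Combining the two bounds\<close>

text \<open>
  A vertex with \<open>d = 1\<close> contributes \<open>k / 2\<close> to either bound, so any multiplier fits it. For \<open>d = 0\<close>
  the greedy bound gains \<open>(k - 2) / 2\<close> over \<open>k / 2\<close> and half the order bound loses \<open>1 / 2\<close>, so
  \<open>k - 2\<close> is the largest multiplier possible.
\<close>

lemma vertex_weight_le:
  fixes k :: real and d :: nat
  assumes "k \<ge> 0"
  shows "(k + 1 - d - k / (d + 1)) + (k - 2) * ((k + 1 - d) / 2) \<le> k * (k - 1) / 2"
proof -
  have "0 \<le> real d * (real d - 1)" by (cases d) auto
  with assms have "0 \<le> k * (real d * (real d - 1))" by (rule mult_nonneg_nonneg)
  then have "0 \<le> k * (real d * (real d - 1)) / (2 * (real d + 1))"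
    by (rule divide_nonneg_pos) simp
  also have "\<dots> = k * (k - 1) / 2 - ((k + 1 - d - k / (d + 1)) + (k - 2) * ((k + 1 - d) / 2))"
    by (simp add: field_simps)
  finally show ?thesis by simp
qed

lemma weighted_independent_domination_bound:
  assumes k: "k \<ge> 2" and reg: "regular k G"
  shows "independent_domination_number G + (real k - 2) * (card (verts G) / 2)
    \<le> (real k - 1) * (k / 2 * domination_number G)"
proof -
  obtain D where D: "dominating_set G D" "card D = domination_number G"
    using minimum_dominating_setE .
  define d where "d v = card (neighbourhood G v \<inter> D)" for v
  have "independent_domination_number G + (real k - 2) * (card (verts G) / 2)
    \<le> (\<Sum>v\<in>D. real k + 1 - d v - k / (d v + 1))
      + (real k - 2) * ((\<Sum>v\<in>D. real k + 1 - d v) / 2)"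
    unfolding d_def
    by (intro add_mono mult_left_mono divide_right_mono
        independent_domination_number_le_greedy_sum[OF reg _ D]
        order_le_dominating_set_sum[OF reg D(1)]) (use k in auto)
  also have "\<dots> = (\<Sum>v\<in>D. (real k + 1 - d v - k / (d v + 1)) + (real k - 2) * ((real k + 1 - d v) / 2))"
    by (simp only: sum.distrib sum_distrib_left sum_divide_distrib)
  also have "\<dots> \<le> (\<Sum>v\<in>D. real k * (real k - 1) / 2)"
    by (rule sum_mono) (rule vertex_weight_le, simp)
  also have "\<dots> = (real k - 1) * (k / 2 * domination_number G)"
    by (simp add: D(2))
  finally show ?thesis .
qed

text \<open>
  In the weighted bound, replace the order by the smaller \<open>2i\<close>. The loss is \<open>k - 2\<close> times
  \<open>n/2 - i\<close>, which must be zero if the resulting inequality is an equality.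
\<close>

lemma independent_domination_number_bound:
  assumes k: "k \<ge> 3" and reg: "regular k G"
  shows "independent_domination_number G \<le> k / 2 * domination_number G"
    and "independent_domination_number G = k / 2 * domination_number G \<Longrightarrow>
      2 * independent_domination_number G = card (verts G)"
proof -
  let ?i = "real (independent_domination_number G)" and ?n = "real (card (verts G))"
  let ?b = "k / 2 * domination_number G"
  have weighted: "?i + (real k - 2) * (?n / 2) \<le> (real k - 1) * ?b"
    by (rule weighted_independent_domination_bound) (use assms in auto)
  have half: "2 * independent_domination_number G \<le> card (verts G)"
    using two_independent_domination_number_le_order[OF reg] k by simp
  then have "?i \<le> ?n / 2" by linarith
  then have "(real k - 2) * ?i \<le> (real k - 2) * (?n / 2)"
    using k by (intro mult_left_mono) auto
  then have "(real k - 1) * ?i \<le> ?i + (real k - 2) * (?n / 2)"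
    unfolding left_diff_distrib by linarith
  also note weighted
  finally show "?i \<le> ?b" using k by simp
  assume "?i = ?b"
  with weighted have "?i + (real k - 2) * (?n / 2) \<le> (real k - 1) * ?i" by (simp only:)
  then have "(real k - 2) * (?n / 2) \<le> (real k - 2) * ?i" by (simp add: algebra_simps)
  then have "?n / 2 \<le> ?i" using k by simp
  then show "2 * independent_domination_number G = card (verts G)" using half by linarith
qed

section \<open>The extremal graphs\<close>

text \<open>
  Along an arc, membership in \<open>A\<close> and membership in \<open>B\<close> both change, so the truth value of
  \<open>x \<in> A \<longleftrightarrow> x \<in> B\<close> is constant on a connected graph.
\<close>

lemma connected_bipartition_unique:
  assumes con: "connected G"
    and A: "independent_set G A" "independent_set G (verts G - A)"
    and B: "independent_set G B" "independent_set G (verts G - B)"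
  shows "B = A \<or> B = verts G - A"
proof -
  have agree: "(y \<in> A \<longleftrightarrow> y \<in> B) \<longleftrightarrow> (x \<in> A \<longleftrightarrow> x \<in> B)"
    if "x \<rightarrow>\<^sup>* y" for x y
    using that
  proof (induction rule: reachable_induct)
    case (step y z)
    have "y \<in> verts G" "z \<in> verts G" using step.hyps adj_in_verts by auto
    with A B step show ?case unfolding independent_set_def by blast
  qed simp
  have "x \<rightarrow>\<^sup>* y" if "x \<in> verts G" "y \<in> verts G" for x y
    using con that unfolding connected_def strongly_connected_def
    by (simp add: reachable_mk_symmetric_eq[OF sym_arcs])
  with agree have "(x \<in> A \<longleftrightarrow> x \<in> B) \<longleftrightarrow> (y \<in> A \<longleftrightarrow> y \<in> B)"
    if "x \<in> verts G" "y \<in> verts G" for x y using that by metis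
  moreover have "A \<subseteq> verts G" "B \<subseteq> verts G" using A B by (auto simp: independent_set_def)
  ultimately show ?thesis by blast
qed

text \<open>
  By the hypothesis, every independent dominating set is one side of a bipartition into equal
  halves. The bipartition is unique, so no independent dominating set contains vertices of
  both sides, and therefore no two vertices of different sides are nonadjacent.
\<close>

lemma extremal_imp_complete_bipartite:
  assumes reg: "regular k G" and k: "k > 0" and con: "connected G"
    and half: "2 * independent_domination_number G = card (verts G)"
  shows "complete_bipartite_digraph k k G"
proof -
  have halves: "2 * card M = card (verts G) \<and> independent_set G (verts G - M)"
    if "independent_set G M" "dominating_set G M" for M
  proof -
    have "2 * card M = card (verts G)"
      using regular_independent_set_le_half[OF reg k that(1)]
        independent_domination_number_le[OF that(2,1)] half by linarith
    with regular_half_independent_set_complement[OF reg that(1)] show ?thesis by blast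
  qed
  obtain A where A: "dominating_set G A" "independent_set G A"
    using ex_independent_dominating_set by blast
  define B where "B = verts G - A"
  have B: "independent_set G B" using halves A by (simp add: B_def)
  have AV: "A \<subseteq> verts G" using A by (simp add: dominating_set_def)
  have complete: "a \<rightarrow>\<^bsub>G\<^esub> b" if a: "a \<in> A" and b: "b \<in> B" for a b
  proof (rule ccontr)
    assume "\<not> a \<rightarrow>\<^bsub>G\<^esub> b"
    then have "independent_set G {a, b}"
      using a b AV not_adjacent_self adjacent_sym by (auto simp: independent_set_def B_def)
    then obtain M where M: "{a, b} \<subseteq> M" "independent_set G M" "dominating_set G M"
      by (rule independent_set_extends)
    have "M = A \<or> M = verts G - A"
      using connected_bipartition_unique[OF con A(2) _ M(2)] B halves M by (simp add: B_def)
    with M(1) a b show False by (auto simp: B_def)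
  qed
  have arcs: "arcs_ends G = A \<times> B \<union> B \<times> A"
  proof
    show "arcs_ends G \<subseteq> A \<times> B \<union> B \<times> A"
    proof
      fix e assume "e \<in> arcs_ends G"
      then obtain x y where e: "e = (x, y)" "x \<rightarrow>\<^bsub>G\<^esub> y" by (cases e) auto
      moreover have "x \<in> A \<union> B" "y \<in> A \<union> B"
        using adj_in_verts[OF e(2)] by (auto simp: B_def)
      ultimately show "e \<in> A \<times> B \<union> B \<times> A"
        using A(2) B unfolding independent_set_def by blast
    qed
    show "A \<times> B \<union> B \<times> A \<subseteq> arcs_ends G" using complete adjacent_sym by auto
  qed
  have "card A = card B"
    using halves[OF A(2,1)] card_Diff_subset[of A "verts G"] AV finite_subset_verts[OF AV]
    unfolding B_def by linarith
  moreover have "card (verts G) > 0" using con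
    by (auto simp: connected_def strongly_connected_def card_gt_0_iff)
  then have "card A > 0" using halves[OF A(2,1)] by auto
  then obtain a where a: "a \<in> A" by (auto simp: card_gt_0_iff)
  have "neighbourhood G a = B" using a arcs by (auto simp: neighbourhood_def B_def)
  then have "card B = k" using card_neighbourhood_regular[OF reg, of a] a AV by auto
  moreover have "verts G = A \<union> B" "A \<inter> B = {}" using AV by (auto simp: B_def)
  ultimately show ?thesis
    using arcs graph_axioms unfolding complete_bipartite_digraph_def by metis
qed

text \<open>
  An independent set lies in one side, and no vertex of this side dominates another one of it,
  so only the two sides are independent dominating sets. A dominating set that misses
  one side contains the whole other side.
\<close>

lemma complete_bipartite_domination_numbers:
  assumes k: "k \<ge> 2" and "complete_bipartite_digraph k k G"
  shows "domination_number G = 2" "independent_domination_number G = k"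
proof -
  obtain A B where AB: "verts G = A \<union> B" "A \<inter> B = {}" "card A = k" "card B = k"
      "arcs_ends G = A \<times> B \<union> B \<times> A"
    using assms by (auto simp: complete_bipartite_digraph_def)
  obtain a where a: "a \<in> A" using AB k by fastforce
  obtain b where b: "b \<in> B" using AB k by fastforce
  have adj: "x \<rightarrow>\<^bsub>G\<^esub> y \<longleftrightarrow> x \<in> A \<and> y \<in> B \<or> x \<in> B \<and> y \<in> A" for x y
    by (simp add: AB(5))
  have part: "S = A \<or> S = B" if "dominating_set G S" "independent_set G S" for S
  proof -
    have S: "S \<subseteq> A \<union> B"
      using \<open>dominating_set G S\<close> by (auto simp: dominating_set_def AB(1))
    have cov: "v \<in> S \<or> (\<exists>u \<in> S. v \<rightarrow>\<^bsub>G\<^esub> u)" if "v \<in> A \<union> B" for v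
      using \<open>dominating_set G S\<close> that by (auto simp: dominating_set_def AB(1))
    have "S \<inter> A = {} \<or> S \<inter> B = {}"
      using \<open>independent_set G S\<close> adj by (auto simp: independent_set_def)
    then show ?thesis
    proof
      assume "S \<inter> A = {}"
      then have "v \<in> S" if "v \<in> B" for v using cov[of v] that adj AB(2) by blast
      with \<open>S \<inter> A = {}\<close> S b show ?thesis by blast
    next
      assume "S \<inter> B = {}"
      then have "v \<in> S" if "v \<in> A" for v using cov[of v] that adj AB(2) by blast
      with \<open>S \<inter> B = {}\<close> S a show ?thesis by blast
    qed
  qed
  show "independent_domination_number G = k"
  proof -
    obtain M where M: "dominating_set G M" "independent_set G M"
        "card M = independent_domination_number G"
      by (rule minimum_independent_dominating_setE)
    from part[OF M(1,2)] M(3) AB(3,4) show ?thesis by auto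
  qed
  have "dominating_set G {a, b}"
    using a b adj by (auto simp: dominating_set_def AB(1))
  then have "domination_number G \<le> card {a, b}" by (rule domination_number_le)
  also have "\<dots> \<le> 2" by (simp add: card_insert_if)
  finally have "domination_number G \<le> 2" .
  moreover obtain D where D: "dominating_set G D" "card D = domination_number G"
    using minimum_dominating_setE .
  have finD: "finite D" using D(1) finite_subset_verts by (auto simp: dominating_set_def)
  have cov: "v \<in> D \<or> (\<exists>u \<in> D. v \<rightarrow>\<^bsub>G\<^esub> u)" if "v \<in> A \<union> B" for v
    using D(1) that by (auto simp: dominating_set_def AB(1))
  have "card D \<ge> 2"
  proof -
    consider "A \<inter> D = {}" | "B \<inter> D = {}" | x y where "x \<in> A \<inter> D" "y \<in> B \<inter> D"
      by blast
    then show ?thesis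
    proof cases
      case 1
      then have "B \<subseteq> D" using cov adj AB(2) by blast
      from card_mono[OF finD this] show ?thesis using AB(4) k by simp
    next
      case 2
      then have "A \<subseteq> D" using cov adj AB(2) by blast
      from card_mono[OF finD this] show ?thesis using AB(3) k by simp
    next
      case 3
      then have "x \<noteq> y" using AB(2) by blast
      then have "card {x, y} = 2" by simp
      then show ?thesis using card_mono[OF finD, of "{x, y}"] 3 by simp
    qed
  qed
  ultimately show "domination_number G = 2" using D by simp
qed

end

theorem theorem3:
  fixes G :: "('a, 'b) pre_digraph" and k :: nat
  assumes "k \<ge> 3"
    and "graph G"
    and "connected G"
    and "regular k G"
  shows "real (independent_domination_number G) / real (domination_number G) \<le> real k / 2
    \<and> (real (independent_domination_number G) / real (domination_number G) = real k / 2
         \<longleftrightarrow> complete_bipartite_digraph k k G)"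
proof -
  interpret graph G by fact
  have "verts G \<noteq> {}" using assms(3) by (auto simp: connected_def strongly_connected_def)
  then have "\<not> dominating_set G {}" by (auto simp: dominating_set_def)
  moreover obtain D where D: "dominating_set G D" "card D = domination_number G"
    by (rule minimum_dominating_setE)
  moreover have "finite D"
    by (rule finite_subset_verts) (use D(1) in \<open>simp add: dominating_set_def\<close>)
  ultimately have pos: "domination_number G > 0"
    unfolding D(2)[symmetric] card_gt_0_iff by blast
  have "real (independent_domination_number G) / domination_number G \<le> k / 2"
    using independent_domination_number_bound(1)[OF assms(1,4)] pos by (simp add: field_simps)
  moreover have "complete_bipartite_digraph k k G"
    if "real (independent_domination_number G) / domination_number G = k / 2"
  proof (rule extremal_imp_complete_bipartite)
    show "2 * independent_domination_number G = card (verts G)"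
      by (rule independent_domination_number_bound(2)[OF assms(1,4)])
        (use that pos in \<open>simp add: field_simps\<close>)
  qed (use assms in auto)
  moreover have "real (independent_domination_number G) / domination_number G = k / 2"
    if "complete_bipartite_digraph k k G"
    using complete_bipartite_domination_numbers[OF _ that] assms(1) by simp
  ultimately show ?thesis by blast
qed

end
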